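(* Let $\eta=\{\eta(t);t\in[0,1]\}$ be a mean zero continuous Gaussian process with covariance $U=\{U(s,t);s,t\in[0,1]\}$ satisfying $U(0,0)>0$. For each integer $k\ge 1$ let $\eta_1,\ldots,\eta_k$ be independent copies of $\eta$ and set $Y_k(t)=\sum_{i=1}^k \eta_i^2(t)$, $t\in[0,1]$. Let $\phi$ be a positive function on $[0,\delta]$ for some $\delta>0$. If $$\limsup_{t\to 0}\frac{\eta(t)-\eta(0)}{\phi(t)}=1\qquad\text{a.s.},$$ then for all integers $k\ge 1$, $$\limsup_{t\to 0}\frac{Y_k(t)-Y_k(0)}{\phi(t)}=2\,Y_k^{1/2}(0)\qquad\text{a.s.}$$
   Context: The process $Y_k=\{Y_k(t),t\in[0,1]\}$ is called a chi-square process of order $k$ with kernel $U$. Here $U(s,t)=E(\eta(s)\eta(t))$, and $Y_k^{1/2}(0)=(Y_k(0))^{1/2}$. Limits as $t\to0$ are taken through $t>0$, $t\in[0,1]$. *)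

theory Defs
  imports "HOL-Probability.Probability"
begin

text \<open>A Gaussian random variable may be degenerate: constants are the Gaussians of variance 0,
  which \<^const>\<open>normal_density\<close> does not cover.\<close>

definition gaussian_rv :: "'a measure \<Rightarrow> ('a \<Rightarrow> real) \<Rightarrow> bool" where
  "gaussian_rv M Z \<longleftrightarrow> Z \<in> borel_measurable M \<and>
     (\<exists>\<mu>. (AE \<omega> in M. Z \<omega> = \<mu>) \<or>
          (\<exists>\<sigma>>0. distributed M lborel Z (normal_density \<mu> \<sigma>)))"

definition gaussian_process :: "'a measure \<Rightarrow> 't set \<Rightarrow> ('t \<Rightarrow> 'a \<Rightarrow> real) \<Rightarrow> bool" where
  "gaussian_process M T X \<longleftrightarrow>
     (\<forall>J c. finite J \<longrightarrow> J \<subseteq> T \<longrightarrow> gaussian_rv M (\<lambda>\<omega>. \<Sum>t\<in>J. c t * X t \<omega>))"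

text \<open>Paths are required to be continuous only almost surely.\<close>

definition continuous_process ::
    "'a measure \<Rightarrow> 't::topological_space set \<Rightarrow> ('t \<Rightarrow> 'a \<Rightarrow> real) \<Rightarrow> bool" where
  "continuous_process M T X \<longleftrightarrow> (AE \<omega> in M. continuous_on T (\<lambda>t. X t \<omega>))"

definition mean_zero_continuous_gaussian_process ::
    "'a measure \<Rightarrow> real set \<Rightarrow> (real \<Rightarrow> real \<Rightarrow> real) \<Rightarrow> (real \<Rightarrow> 'a \<Rightarrow> real) \<Rightarrow> bool" where
  "mean_zero_continuous_gaussian_process M T U X \<longleftrightarrow>
     gaussian_process M T X \<and> continuous_process M T X \<and>
     (\<forall>t\<in>T. prob_space.expectation M (X t) = 0) \<and>
     (\<forall>s\<in>T. \<forall>t\<in>T. U s t = prob_space.expectation M (\<lambda>\<omega>. X s \<omega> * X t \<omega>))"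

text \<open>A process viewed as a random element of the product space of real functions on \<open>T\<close>.\<close>

definition path :: "'t set \<Rightarrow> ('t \<Rightarrow> 'a \<Rightarrow> real) \<Rightarrow> 'a \<Rightarrow> 't \<Rightarrow> real" where
  "path T X \<omega> = (\<lambda>t\<in>T. X t \<omega>)"

abbreviation path_space :: "'t set \<Rightarrow> ('t \<Rightarrow> real) measure" where
  "path_space T \<equiv> PiM T (\<lambda>_. borel)"

text \<open>The copies may live on a different probability space \<open>N\<close>. Equality of laws on the product
  space does not see path continuity, so a copy of a continuous process is required
  to be continuous explicitly.\<close>

definition independent_copies ::
    "'b measure \<Rightarrow> 'i set \<Rightarrow> ('i \<Rightarrow> 't::topological_space \<Rightarrow> 'b \<Rightarrow> real) \<Rightarrow>
     'a measure \<Rightarrow> 't set \<Rightarrow> ('t \<Rightarrow> 'a \<Rightarrow> real) \<Rightarrow> bool" where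
  "independent_copies N I X M T \<eta> \<longleftrightarrow>
     prob_space.indep_vars N (\<lambda>_. path_space T) (\<lambda>i. path T (X i)) I \<and>
     (\<forall>i\<in>I. distr N (path_space T) (path T (X i)) = distr M (path_space T) (path T \<eta>) \<and>
            (continuous_process M T \<eta> \<longrightarrow> continuous_process N T (X i)))"

definition chi_square_process :: "(nat \<Rightarrow> 't \<Rightarrow> 'b \<Rightarrow> real) \<Rightarrow> nat \<Rightarrow> 't \<Rightarrow> 'b \<Rightarrow> real" where
  "chi_square_process X k t \<omega> = (\<Sum>i=1..k. (X i t \<omega>)\<^sup>2)"

end

theory Submission
  imports Defs
begin

text \<open>
  Write \<open>\<Delta>\<^sub>i(t) = X\<^sub>i(t) - X\<^sub>i(0)\<close>. Since \<open>Y\<^sub>k(t) - Y\<^sub>k(0) = \<Sum>\<^sub>i \<Delta>\<^sub>i(t)\<^sup>2 + 2 \<Sum>\<^sub>i X\<^sub>i(0) \<Delta>\<^sub>i(t)\<close>, everything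
  depends on the function \<open>L(a) = limsup\<^sub>t \<Sum>\<^sub>i a\<^sub>i \<Delta>\<^sub>i(t) / \<phi>(t)\<close> of a vector \<open>a\<close>. For a fixed unit
  vector \<open>a\<close> the process \<open>\<Sum>\<^sub>i a\<^sub>i X\<^sub>i\<close> has the law of \<open>\<eta>\<close>, because centered Gaussian laws are
  invariant under rotation; hence \<open>L(a) = \<bar>a\<bar>\<close> almost surely, for each fixed \<open>a\<close>. Applied to the
  vectors \<open>\<plusminus>e\<^sub>i\<close> this gives \<open>\<bar>\<Delta>\<^sub>i\<bar> \<le> 2 \<phi>\<close> near 0. So the squares \<open>\<Delta>\<^sub>i\<^sup>2 / \<phi>\<close> vanish in the limit by
  continuity of the paths, and \<open>L\<close> is Lipschitz. Off one null set \<open>L(a) = \<bar>a\<bar>\<close> holds for all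
  rational \<open>a\<close>, hence by density and path by path at the random vector \<open>a = X(0)\<close>.

  Two points need care. Nothing is known about \<open>\<phi>\<close> except positivity, so it is not clear that the
  limit superior is determined by the law of the process. It is, since for continuous paths it may be
  computed along a countable set of times that depends only on \<open>\<phi>\<close>: one over which the graph of
  \<open>\<phi>\<close> is dense in the whole graph (\<open>Limsup_at_right_eq_countable\<close>, \<open>AE_Limsup_transfer\<close>). And
  equality of laws on path space is obtained from characteristic functions of finite linear
  combinations (\<open>PiM_borel_eqI_char\<close>), which are explicit for Gaussian processes
  (\<open>distr_path_unit_combination\<close>).
\<close>

section \<open>Characteristic functions determine the law of a process\<close>

text \<open>
  Levy's uniqueness theorem for a measure with a bounded signed density \<open>w\<close>. Keeping one coordinate
  as the variable and absorbing the others into \<open>w\<close>, this allows the several-dimensional uniqueness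
  theorem to be proved one coordinate at a time.
\<close>

lemma Levy_uniqueness_weighted:
  fixes X w :: "'a \<Rightarrow> real"
  assumes "prob_space P" "prob_space Q" and sets_eq: "sets P = sets Q"
    and X: "X \<in> borel_measurable P" and w: "w \<in> borel_measurable P" and w_bound: "\<And>x. \<bar>w x\<bar> \<le> 1"
    and char_eq: "\<And>u. (CLINT x|P. iexp (u * X x)) = (CLINT x|Q. iexp (u * X x))"
    and wchar_eq: "\<And>u. (CLINT x|P. w x *\<^sub>R iexp (u * X x)) = (CLINT x|Q. w x *\<^sub>R iexp (u * X x))"
    and A: "A \<in> sets borel"
  shows "(LINT x|P. w x * indicator A (X x)) = (LINT x|Q. w x * indicator A (X x))"
proof -
  interpret P: prob_space P by fact
  interpret Q: prob_space Q by fact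
  note [measurable] = X w A
  have XQ[measurable]: "X \<in> borel_measurable Q" and [measurable]: "w \<in> borel_measurable Q"
    using X w by (simp_all add: measurable_cong_sets[OF sets_eq[symmetric] refl])
  have int_w: "(LINT x|P. w x) = (LINT x|Q. w x)"
  proof -
    have "complex_of_real (LINT x|P. w x) = complex_of_real (LINT x|Q. w x)"
      using wchar_eq[of 0] by (simp flip: integral_complex_of_real add: scaleR_conv_of_real)
    then show ?thesis by simp
  qed
  have intg: "integrable R (\<lambda>x. g x *\<^sub>R h x)"
    if "prob_space R" "g \<in> borel_measurable R" "h \<in> borel_measurable R" "\<And>x. \<bar>g x\<bar> \<le> 3" "\<And>x. norm (h x) \<le> 1"
    for R :: "'a measure" and g :: "'a \<Rightarrow> real" and h :: "'a \<Rightarrow> 'b::{banach,second_countable_topology}"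
  proof -
    interpret R: prob_space R by fact
    have "norm (g x *\<^sub>R h x) \<le> 3" for x
      using mult_mono[OF that(4,5)[of x]] by simp
    then show ?thesis
      using that by (intro R.integrable_const_bound[where B=3]) auto
  qed
  \<comment> \<open>Tilting by the density proportional to the positive function \<open>2 + v\<close>, with \<open>v = w\<close> or \<open>v = 0\<close>,
    turns the weighted statement into uniqueness for probability measures.\<close>
  have tilted: "(LINT x|P. (2 + v x) * indicator A (X x)) = (LINT x|Q. (2 + v x) * indicator A (X x))"
    if v[measurable]: "v \<in> borel_measurable P" "v \<in> borel_measurable Q" and vb: "\<And>x. \<bar>v x\<bar> \<le> 1"
      and v_int: "(LINT x|P. v x) = (LINT x|Q. v x)"
      and v_char: "\<And>u. (CLINT x|P. v x *\<^sub>R iexp (u * X x)) = (CLINT x|Q. v x *\<^sub>R iexp (u * X x))"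
    for v
  proof -
    define c where "c = 2 + (LINT x|P. v x)"
    have vb': "- 1 \<le> v x" "v x \<le> 1" for x using vb[of x] by auto
    have vb3: "\<bar>v x\<bar> \<le> 3" for x using vb[of x] by linarith
    have "integrable P v"
      using intg[of P v "\<lambda>_. 1::real"] vb3 by (simp add: P.prob_space_axioms)
    moreover have "integrable Q v"
      using intg[of Q v "\<lambda>_. 1::real"] vb3 by (simp add: Q.prob_space_axioms)
    ultimately have cP: "(LINT x|P. (2 + v x)) = c" and cQ: "(LINT x|Q. (2 + v x)) = c"
      and intvP: "integrable P (\<lambda>x. 2 + v x)" and intvQ: "integrable Q (\<lambda>x. 2 + v x)"
      by (auto simp: c_def v_int P.prob_space Q.prob_space)
    \<comment> \<open>The total mass \<open>c\<close> of the density \<open>2 + v\<close> must not vanish, as it is used to normalise.\<close>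
    have "(LINT x|P. (1::real)) \<le> (LINT x|P. (2 + v x))"
      using intvP vb'(1) by (intro integral_mono) (auto simp: algebra_simps, smt (verit))
    then have c: "c \<ge> 1" by (simp add: cP P.prob_space)
    define D where "D R = distr (density R (\<lambda>x. (2 + v x) / c)) borel X" for R
    have nn: "0 \<le> (2 + v x) / c" for x using c vb'(1)[of x] by auto
    have D: "real_distribution (D R)"
        "\<And>u. char (D R) u = (2 * (CLINT x|R. iexp (u * X x)) + (CLINT x|R. v x *\<^sub>R iexp (u * X x))) / c"
        "measure (D R) A = (LINT x|R. (2 + v x) * indicator A (X x)) / c"
      if R: "prob_space R" and [measurable]: "v \<in> borel_measurable R" "X \<in> borel_measurable R"
        and Rc: "(LINT x|R. (2 + v x)) = c" and Ri: "integrable R (\<lambda>x. 2 + v x)" for R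
    proof -
      interpret R: prob_space R by fact
      have "emeasure (density R (\<lambda>x. (2 + v x) / c)) (space R) = (\<integral>\<^sup>+x. ennreal ((2 + v x) / c) \<partial>R)"
        by (subst emeasure_density) (auto intro!: nn_integral_cong)
      also have "\<dots> = ennreal (LINT x|R. (2 + v x) / c)"
        by (rule nn_integral_eq_integral) (use Ri nn in auto)
      also have "\<dots> = 1" using c Rc by (simp)
      finally have pd: "prob_space (density R (\<lambda>x. (2 + v x) / c))"
        by (intro prob_spaceI) simp
      interpret Rd: prob_space "density R (\<lambda>x. (2 + v x) / c)" by (rule pd)
      show rd: "real_distribution (D R)"
        unfolding D_def by (rule Rd.real_distribution_distr) simp
      have i1: "integrable R (\<lambda>x. 2 *\<^sub>R iexp (u * X x))" and i2: "integrable R (\<lambda>x. v x *\<^sub>R iexp (u * X x))" for u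
        using vb3 by (auto intro!: intg R simp del: scaleR_conv_of_real)
      show "char (D R) u = (2 * (CLINT x|R. iexp (u * X x)) + (CLINT x|R. v x *\<^sub>R iexp (u * X x))) / c" for u
      proof -
        have "char (D R) u = (CLINT x|R. ((2 + v x) / c) *\<^sub>R iexp (u * X x))"
          unfolding D_def char_def using nn by (simp add: integral_distr integral_density del: scaleR_conv_of_real)
        also have "\<dots> = (CLINT x|R. (2 *\<^sub>R iexp (u * X x) + v x *\<^sub>R iexp (u * X x)) /\<^sub>R c)"
          by (intro Bochner_Integration.integral_cong) (auto simp: scaleR_add_left algebra_simps divide_inverse)
        also have "\<dots> = (2 *\<^sub>R (CLINT x|R. iexp (u * X x)) + (CLINT x|R. v x *\<^sub>R iexp (u * X x))) /\<^sub>R c"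
          using i1 i2 by (simp add: Bochner_Integration.integral_add)
        finally show ?thesis by (simp add: scaleR_conv_of_real divide_inverse)
      qed
      have "measure (D R) A = (LINT y|D R. indicator A y)"
        using rd by (simp add: real_distribution.events_eq_borel D_def)
      also have "\<dots> = (LINT x|R. ((2 + v x) / c) *\<^sub>R indicator A (X x))"
        unfolding D_def using nn by (subst integral_distr) (simp_all add: integral_density)
      also have "\<dots> = (LINT x|R. ((2 + v x) * indicator A (X x)) / c)"
        by simp
      also have "\<dots> = (LINT x|R. ((2 + v x) * indicator A (X x))) / c"
        by (rule integral_divide_zero)
      finally show "measure (D R) A = (LINT x|R. (2 + v x) * indicator A (X x)) / c" .
    qed
    note DP = D[OF P.prob_space_axioms v(1) X cP intvP]
    note DQ = D[OF Q.prob_space_axioms v(2) XQ cQ intvQ]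
    have "char (D P) = char (D Q)"
      by (rule ext) (simp only: DP(2) DQ(2) v_char char_eq)
    then have "D P = D Q"
      using DP(1) DQ(1) by (intro Levy_uniqueness) auto
    then show ?thesis using DP(3) DQ(3) c by simp
  qed
  have i: "integrable P (\<lambda>x. 2 * indicat_real A (X x))" "integrable P (\<lambda>x. w x * indicator A (X x))"
      "integrable Q (\<lambda>x. 2 * indicat_real A (X x))" "integrable Q (\<lambda>x. w x * indicator A (X x))"
    using intg[of P "\<lambda>_. 2" "\<lambda>x. indicator A (X x)::real"] intg[of P w "\<lambda>x. indicator A (X x)::real"]
      intg[of Q "\<lambda>_. 2" "\<lambda>x. indicator A (X x)::real"] intg[of Q w "\<lambda>x. indicator A (X x)::real"]
      order_trans[OF w_bound, of 3]
    by (auto simp: indicator_def P.prob_space_axioms Q.prob_space_axioms)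
  have "(LINT x|P. 2 * indicat_real A (X x)) = (LINT x|Q. 2 * indicat_real A (X x))"
    using tilted[of "\<lambda>_. 0", unfolded add_0_right] by (simp only: Bochner_Integration.integral_zero simp_thms abs_zero zero_le_one measurable_const scaleR_zero_left UNIV_I space_borel borel_measurable_const)
  moreover have "(LINT x|P. (2 + w x) * indicator A (X x)) = (LINT x|Q. (2 + w x) * indicator A (X x))"
  proof (rule tilted)
    show "w \<in> borel_measurable P" "w \<in> borel_measurable Q" by measurable
  qed (rule w_bound int_w wchar_eq)+
  moreover have "(LINT x|P. (2 + w x) * indicator A (X x)) =
      (LINT x|P. 2 * indicat_real A (X x)) + (LINT x|P. w x * indicator A (X x))"
    unfolding distrib_right by (intro Bochner_Integration.integral_add i)
  moreover have "(LINT x|Q. (2 + w x) * indicator A (X x)) =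
      (LINT x|Q. 2 * indicat_real A (X x)) + (LINT x|Q. w x * indicator A (X x))"
    unfolding distrib_right by (intro Bochner_Integration.integral_add i)
  ultimately show ?thesis by linarith
qed

text \<open>
  The exponential of a linear functional is traded for indicators, one coordinate \<open>X\<^sub>j\<close> at a time.
  The set \<open>L\<close> stands for the linear functionals of the coordinates; closure under addition and scaling
  makes \<open>\<plusminus>f + u X\<^sub>j\<close> available in the induction step.
\<close>

lemma integral_indicator_iexp_eqI:
  fixes L :: "('a \<Rightarrow> real) set"
  assumes P: "prob_space P" and Q: "prob_space Q" and sets_eq: "sets P = sets Q"
    and L: "L \<subseteq> borel_measurable P"
    and L_add: "\<And>f g. f \<in> L \<Longrightarrow> g \<in> L \<Longrightarrow> (\<lambda>x. f x + g x) \<in> L"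
    and L_scale: "\<And>c f. f \<in> L \<Longrightarrow> (\<lambda>x. c * f x) \<in> L"
    and char_eq: "\<And>f. f \<in> L \<Longrightarrow> (CLINT x|P. iexp (f x)) = (CLINT x|Q. iexp (f x))"
    and "finite J" "\<And>j. j \<in> J \<Longrightarrow> X j \<in> L" "\<And>j. j \<in> J \<Longrightarrow> A j \<in> sets borel" "f \<in> L"
  shows "(CLINT x|P. (\<Prod>j\<in>J. indicator (A j) (X j x)) *\<^sub>R iexp (f x)) =
         (CLINT x|Q. (\<Prod>j\<in>J. indicator (A j) (X j x)) *\<^sub>R iexp (f x))"
  using assms(8-)
proof (induction J arbitrary: f)
  case empty
  then show ?case by (simp add: char_eq)
next
  case (insert j J)
  interpret P: prob_space P by (rule P)
  interpret Q: prob_space Q by (rule Q)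
  define p :: "'a \<Rightarrow> real" where "p x = (\<Prod>j\<in>J. indicator (A j) (X j x))" for x
  have [measurable]: "g \<in> borel_measurable P" "g \<in> borel_measurable Q" if "g \<in> L" for g
    using L that by (auto simp: measurable_cong_sets[OF sets_eq[symmetric] refl])
  have [measurable]: "X j \<in> borel_measurable P" "X j \<in> borel_measurable Q"
    using insert.prems by auto
  have [measurable]: "f \<in> borel_measurable P" "f \<in> borel_measurable Q" "A j \<in> sets borel"
    using insert.prems by auto
  have p_meas[measurable]: "p \<in> borel_measurable P" "p \<in> borel_measurable Q"
    unfolding p_def using insert.prems by (auto intro!: borel_measurable_prod measurable_compose[of "X _" _ borel])
  have p01: "0 \<le> p x" "p x \<le> 1" for x
    unfolding p_def by (auto intro!: prod_nonneg prod_le_1)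
  have IH: "(CLINT x|P. p x *\<^sub>R iexp (g x)) = (CLINT x|Q. p x *\<^sub>R iexp (g x))" if "g \<in> L" for g
    unfolding p_def using insert.IH[of g] insert.prems that by auto
  have ig: "integrable R (\<lambda>x. p x *\<^sub>R h x)"
    if "prob_space R" "p \<in> borel_measurable R" "h \<in> borel_measurable R" "\<And>x. norm (h x) \<le> 1"
    for R and h :: "'a \<Rightarrow> 'e::{banach,second_countable_topology}"
  proof -
    interpret R: prob_space R by fact
    have "norm (p x *\<^sub>R h x) \<le> 1" for x
      using mult_mono[OF p01(2)[of x] that(4)[of x]] p01(1)[of x] by simp
    then show ?thesis
      using that by (intro R.integrable_const_bound[where B=1]) auto
  qed
  \<comment> \<open>The real weights to which the one-dimensional lemma applies are \<open>p cos f\<close> and \<open>p sin f\<close>;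
    by Euler's formulas they reduce to the induction hypothesis at \<open>\<plusminus>f + u X\<^sub>j\<close>.\<close>
  have shift: "(\<lambda>x. s * f x + u * X j x) \<in> L" for s u
    using insert.prems by (intro L_add L_scale) auto
  have split: "(CLINT x|R. p x *\<^sub>R iexp (f x + u * X j x)) + a * (CLINT x|R. p x *\<^sub>R iexp (- f x + u * X j x))
      = (CLINT x|R. p x *\<^sub>R ((iexp (f x) + a * iexp (- f x)) * iexp (u * X j x)))"
    if "prob_space R" "p \<in> borel_measurable R" "f \<in> borel_measurable R" "X j \<in> borel_measurable R" for R u a
  proof -
    note [measurable] = that(2-)
    have "(CLINT x|R. p x *\<^sub>R ((iexp (f x) + a * iexp (- f x)) * iexp (u * X j x))) =
       (CLINT x|R. p x *\<^sub>R iexp (f x + u * X j x) + a * (p x *\<^sub>R iexp (- f x + u * X j x)))"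
      by (intro Bochner_Integration.integral_cong)
        (auto simp: algebra_simps scaleR_conv_of_real exp_add exp_diff divide_inverse exp_minus)
    also have "\<dots> = (CLINT x|R. p x *\<^sub>R iexp (f x + u * X j x)) + (CLINT x|R. a * (p x *\<^sub>R iexp (- f x + u * X j x)))"
      using that by (intro Bochner_Integration.integral_add integrable_mult_right ig) auto
    finally show ?thesis by (simp only: integral_mult_right_zero)
  qed
  have eq: "(CLINT x|P. p x *\<^sub>R ((iexp (f x) + a * iexp (- f x)) * iexp (u * X j x))) =
     (CLINT x|Q. p x *\<^sub>R ((iexp (f x) + a * iexp (- f x)) * iexp (u * X j x)))" for a u
    using IH[OF shift[of 1 u]] IH[OF shift[of "-1" u]]
    by (subst (1 2) split[symmetric]) (auto simp: P Q)
  have cos_eq: "complex_of_real (cos y) = (iexp y + 1 * iexp (- y)) / 2" for y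
    by (simp add: cos_exp_eq flip: cos_of_real)
  have sin_eq: "complex_of_real (sin y) = (iexp y + (-1) * iexp (- y)) / (2 * \<i>)" for y
    by (simp add: sin_exp_eq flip: sin_of_real)
  have C: "(LINT x|P. (p x * cos (f x)) * indicator (A j) (X j x)) = (LINT x|Q. (p x * cos (f x)) * indicator (A j) (X j x))"
  proof (rule Levy_uniqueness_weighted[OF P Q sets_eq])
    show "\<bar>p x * cos (f x)\<bar> \<le> 1" for x
      using mult_mono[OF p01(2)[of x] abs_cos_le_one[of "f x"]] p01(1)[of x] by (simp add: abs_mult)
    show "(CLINT x|P. iexp (u * X j x)) = (CLINT x|Q. iexp (u * X j x))" for u
      using char_eq[OF shift[of 0 u]] by simp
    have r: "(p x * cos (f x)) *\<^sub>R iexp (u * X j x) = (p x *\<^sub>R ((iexp (f x) + 1 * iexp (- f x)) * iexp (u * X j x))) / 2" for x u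
      by (simp add: scaleR_conv_of_real cos_eq)
    show "(CLINT x|P. (p x * cos (f x)) *\<^sub>R iexp (u * X j x)) = (CLINT x|Q. (p x * cos (f x)) *\<^sub>R iexp (u * X j x))" for u
      by (simp only: r integral_divide_zero eq[of 1 u])
  qed auto
  have S: "(LINT x|P. (p x * sin (f x)) * indicator (A j) (X j x)) = (LINT x|Q. (p x * sin (f x)) * indicator (A j) (X j x))"
  proof (rule Levy_uniqueness_weighted[OF P Q sets_eq])
    show "\<bar>p x * sin (f x)\<bar> \<le> 1" for x
      using mult_mono[OF p01(2)[of x] abs_sin_le_one[of "f x"]] p01(1)[of x] by (simp add: abs_mult)
    show "(CLINT x|P. iexp (u * X j x)) = (CLINT x|Q. iexp (u * X j x))" for u
      using char_eq[OF shift[of 0 u]] by simp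
    have r: "(p x * sin (f x)) *\<^sub>R iexp (u * X j x) = (p x *\<^sub>R ((iexp (f x) + (-1) * iexp (- f x)) * iexp (u * X j x))) / (2 * \<i>)" for x u
      by (simp add: scaleR_conv_of_real sin_eq)
    show "(CLINT x|P. (p x * sin (f x)) *\<^sub>R iexp (u * X j x)) = (CLINT x|Q. (p x * sin (f x)) *\<^sub>R iexp (u * X j x))" for u
      by (simp only: r integral_divide_zero eq[of "-1" u])
  qed auto
  have "(CLINT x|R. (\<Prod>j\<in>insert j J. indicator (A j) (X j x)) *\<^sub>R iexp (f x)) =
      complex_of_real (LINT x|R. (p x * cos (f x)) * indicator (A j) (X j x)) +
      \<i> * complex_of_real (LINT x|R. (p x * sin (f x)) * indicator (A j) (X j x))"
    if R: "prob_space R" and [measurable]: "p \<in> borel_measurable R" "f \<in> borel_measurable R" "X j \<in> borel_measurable R" for R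
  proof -
    have "integrable R (\<lambda>x. (p x * cos (f x)) * indicator (A j) (X j x))"
        "integrable R (\<lambda>x. (p x * sin (f x)) * indicator (A j) (X j x))"
      using ig[OF R, of "\<lambda>x. cos (f x) * indicator (A j) (X j x)"] ig[OF R, of "\<lambda>x. sin (f x) * indicator (A j) (X j x)"]
      by (auto simp: indicator_def mult.assoc)
    then have "complex_of_real (LINT x|R. (p x * cos (f x)) * indicator (A j) (X j x)) +
      \<i> * complex_of_real (LINT x|R. (p x * sin (f x)) * indicator (A j) (X j x)) =
      (CLINT x|R. complex_of_real ((p x * cos (f x)) * indicator (A j) (X j x)) +
        \<i> * complex_of_real ((p x * sin (f x)) * indicator (A j) (X j x)))"
      by (subst Bochner_Integration.integral_add) (auto simp del: of_real_mult)
    also have "\<dots> = (CLINT x|R. (\<Prod>j\<in>insert j J. indicator (A j) (X j x)) *\<^sub>R iexp (f x))"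
      using insert.hyps
      by (intro Bochner_Integration.integral_cong)
        (auto simp: p_def scaleR_conv_of_real algebra_simps simp flip: cis_conv_exp
           intro!: complex_eqI split: split_indicator)
    finally show ?thesis ..
  qed
  from this[OF P] this[OF Q] show ?case by (simp add: C S)
qed

text \<open>
  The theorem of Cramer and Wold for processes. The \<open>\<pi>\<close>-system of finite-dimensional rectangles
  determines a probability law on the product space, and the mass of a rectangle is the integral of a
  product of indicators of coordinates.
\<close>

lemma PiM_borel_eqI_char:
  fixes P Q :: "('t \<Rightarrow> real) measure"
  assumes P: "prob_space P" and Q: "prob_space Q"
    and sets: "sets P = sets (path_space T)" "sets Q = sets (path_space T)"
    and char_eq: "\<And>J c. finite J \<Longrightarrow> J \<subseteq> T \<Longrightarrow>
      (CLINT x|P. iexp (\<Sum>t\<in>J. c t * x t)) = (CLINT x|Q. iexp (\<Sum>t\<in>J. c t * x t))"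
  shows "P = Q"
proof (rule measure_eqI_PiM_infinite[OF sets])
  interpret P: prob_space P by (rule P)
  interpret Q: prob_space Q by (rule Q)
  show "finite_measure P" by (rule P.finite_measure)
  fix A :: "'t \<Rightarrow> real set" and J
  assume J: "finite J" "J \<subseteq> T" and A: "\<And>i. i \<in> J \<Longrightarrow> A i \<in> sets borel"
  let ?S = "prod_emb T (\<lambda>_. borel) J (Pi\<^sub>E J A)"
  define L :: "(('t \<Rightarrow> real) \<Rightarrow> real) set" where "L = range (\<lambda>c x. \<Sum>t\<in>J. c t * x t)"
  have L_meas: "L \<subseteq> borel_measurable P"
    using J unfolding L_def measurable_cong_sets[OF sets(1) refl] by (auto intro!: borel_measurable_sum)
  have L_add: "(\<lambda>x. f x + g x) \<in> L" if "f \<in> L" "g \<in> L" for f g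
  proof -
    from that obtain c d where "f = (\<lambda>x. \<Sum>t\<in>J. c t * x t)" "g = (\<lambda>x. \<Sum>t\<in>J. d t * x t)"
      by (auto simp: L_def)
    then show ?thesis unfolding L_def
      by (intro range_eqI[of _ _ "\<lambda>t. c t + d t"]) (auto simp: sum.distrib distrib_right)
  qed
  have L_scale: "(\<lambda>x. a * f x) \<in> L" if "f \<in> L" for f a
  proof -
    from that obtain c where "f = (\<lambda>x. \<Sum>t\<in>J. c t * x t)"
      by (auto simp: L_def)
    then show ?thesis unfolding L_def
      by (intro range_eqI[of _ _ "\<lambda>t. a * c t"]) (auto simp: sum_distrib_left mult.assoc)
  qed
  have L_proj: "(\<lambda>x. x j) \<in> L" if "j \<in> J" for j
    unfolding L_def using that J
    by (intro range_eqI[of _ _ "\<lambda>t. if t = j then 1 else 0"]) (auto simp: if_distrib[of "\<lambda>a. a * _"] sum.delta cong: if_cong)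
  have L_zero: "(\<lambda>x. 0) \<in> L"
    unfolding L_def by (intro range_eqI[of _ _ "\<lambda>t. 0"]) auto
  have "(CLINT x|P. (\<Prod>j\<in>J. indicator (A j) (x j)) *\<^sub>R iexp 0) = (CLINT x|Q. (\<Prod>j\<in>J. indicator (A j) (x j)) *\<^sub>R iexp 0)"
    by (rule integral_indicator_iexp_eqI[where X = "\<lambda>j x. x j", OF P Q _ L_meas L_add L_scale])
      (use J A L_proj L_zero char_eq sets in \<open>auto simp: L_def\<close>)
  moreover have "(CLINT x|R. (\<Prod>j\<in>J. indicator (A j) (x j)) *\<^sub>R iexp 0) = complex_of_real (measure R ?S)"
    if sR: "sets R = sets (path_space T)" for R
  proof -
    have sp: "space R = space (path_space T)" using sR by (rule sets_eq_imp_space_eq)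
    have S: "?S \<in> sets R" unfolding sR using J A by (intro sets_PiM_I) auto
    have "(CLINT x|R. (\<Prod>j\<in>J. indicator (A j) (x j)) *\<^sub>R iexp 0) = (CLINT x|R. complex_of_real (indicator ?S x))"
    proof (intro Bochner_Integration.integral_cong refl)
      fix x assume "x \<in> space R"
      then have "x \<in> ?S \<longleftrightarrow> (\<forall>j\<in>J. x j \<in> A j)"
        using J unfolding sp prod_emb_def by (auto simp: space_PiM PiE_iff restrict_def extensional_def)
      moreover have "(\<Prod>j\<in>J. indicator (A j) (x j) :: real) = (if \<forall>j\<in>J. x j \<in> A j then 1 else 0)"
        using J by (auto simp: indicator_def)
      ultimately show "(\<Prod>j\<in>J. indicator (A j) (x j)) *\<^sub>R iexp 0 = complex_of_real (indicator ?S x)"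
        by (auto simp: indicator_def)
    qed
    also have "\<dots> = complex_of_real (measure R ?S)"
      using S sets.sets_into_space[OF S] by (subst integral_complex_of_real) (auto simp: Int_absorb2)
    finally show ?thesis .
  qed
  ultimately have "measure P ?S = measure Q ?S"
    using sets by simp
  then show "emeasure P ?S = emeasure Q ?S"
    by (simp add: P.emeasure_eq_measure Q.emeasure_eq_measure)
qed

section \<open>Unit combinations of independent Gaussian copies\<close>

lemma integrable_gaussian_rv:
  assumes "prob_space M" "gaussian_rv M Z"
  shows "integrable M Z"
proof -
  interpret prob_space M by fact
  from assms(2) have [measurable]: "Z \<in> borel_measurable M" by (simp add: gaussian_rv_def)
  from assms(2) obtain \<mu> where "(AE \<omega> in M. Z \<omega> = \<mu>) \<or> (\<exists>\<sigma>>0. distributed M lborel Z (normal_density \<mu> \<sigma>))"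
    by (auto simp: gaussian_rv_def)
  then show ?thesis
  proof
    assume "AE \<omega> in M. Z \<omega> = \<mu>"
    then show ?thesis
      by (subst integrable_cong_AE[where g = "\<lambda>_. \<mu>"]) auto
  next
    assume "\<exists>\<sigma>>0. distributed M lborel Z (normal_density \<mu> \<sigma>)"
    then obtain \<sigma> where "\<sigma> > 0" "distributed M lborel Z (normal_density \<mu> \<sigma>)" by auto
    then show ?thesis
      using distributed_integrable[of M lborel Z "normal_density \<mu> \<sigma>" "\<lambda>x. x"] integrable_normal_moment_nz_1[of \<sigma> \<mu>]
      by simp
  qed
qed

text \<open>
  The degenerate case is the constant 0, with \<open>\<sigma> = 0\<close>.
\<close>

lemma char_centered_gaussian_rv:
  assumes "prob_space M" "gaussian_rv M Z" "prob_space.expectation M Z = 0"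
  obtains \<sigma> where "\<And>u. (CLINT \<omega>|M. iexp (u * Z \<omega>)) = complex_of_real (exp (- (u\<^sup>2 * \<sigma>\<^sup>2) / 2))"
proof -
  interpret prob_space M by fact
  from assms(2) have [measurable]: "Z \<in> borel_measurable M" by (simp add: gaussian_rv_def)
  from assms(2) obtain \<mu> where "(AE \<omega> in M. Z \<omega> = \<mu>) \<or> (\<exists>\<sigma>>0. distributed M lborel Z (normal_density \<mu> \<sigma>))"
    by (auto simp: gaussian_rv_def)
  then show ?thesis
  proof
    assume Z: "AE \<omega> in M. Z \<omega> = \<mu>"
    then have "expectation Z = expectation (\<lambda>_. \<mu>)"
      by (intro integral_cong_AE) auto
    then have "\<mu> = 0" using assms(3) by (simp add: prob_space)
    have "(CLINT \<omega>|M. iexp (u * Z \<omega>)) = (CLINT \<omega>|M. 1)" for u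
      using Z by (intro integral_cong_AE) (auto simp: \<open>\<mu> = 0\<close>)
    then show ?thesis by (intro that[of 0]) (simp add: prob_space)
  next
    assume "\<exists>\<sigma>>0. distributed M lborel Z (normal_density \<mu> \<sigma>)"
    then obtain \<sigma> where \<sigma>: "\<sigma> > 0" and D: "distributed M lborel Z (normal_density \<mu> \<sigma>)" by auto
    have "\<mu> = 0" using normal_distributed_expectation[OF \<sigma> D] assms(3) by simp
    then have S: "distributed M lborel (\<lambda>\<omega>. Z \<omega> / \<sigma>) std_normal_density"
      using D normal_standard_normal_convert[OF \<sigma>, of Z \<mu>] by simp
    have "(CLINT \<omega>|M. iexp (u * Z \<omega>)) = complex_of_real (exp (- (u\<^sup>2 * \<sigma>\<^sup>2) / 2))" for u
    proof -
      have "(CLINT \<omega>|M. iexp (u * Z \<omega>)) = (CLINT \<omega>|M. iexp ((u * \<sigma>) * (Z \<omega> / \<sigma>)))"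
        using \<sigma> by simp
      also have "\<dots> = char (distr M lborel (\<lambda>\<omega>. Z \<omega> / \<sigma>)) (u * \<sigma>)"
        unfolding char_def by (subst integral_distr) auto
      also have "distr M lborel (\<lambda>\<omega>. Z \<omega> / \<sigma>) = std_normal_distribution"
        using distributed_distr_eq_density[OF S] .
      finally show ?thesis by (simp add: char_std_normal_distribution power_mult_distrib)
    qed
    then show ?thesis by (rule that)
  qed
qed

lemma gaussian_process_imp_gaussian_rv:
  assumes "gaussian_process M T X" "t \<in> T"
  shows "gaussian_rv M (X t)"
  using assms(1)[unfolded gaussian_process_def, rule_format, of "{t}" "\<lambda>_. 1"] assms(2) by simp

lemma gaussian_process_measurable_path:
  assumes "gaussian_process M T X"
  shows "path T X \<in> measurable M (path_space T)"
proof -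
  have "X t \<in> borel_measurable M" if "t \<in> T" for t
    using gaussian_process_imp_gaussian_rv[OF assms that] by (simp add: gaussian_rv_def)
  then show ?thesis unfolding path_def by (intro measurable_restrict)
qed

text \<open>
  Rotation invariance. If the linear functional \<open>\<Lambda>\<close> of a path of \<open>\<eta>\<close> has variance \<open>\<sigma>\<^sup>2\<close>, then by
  independence the characteristic function of \<open>\<Lambda>\<close> on the combined path is
  \<open>\<Prod>\<^sub>i exp (- a\<^sub>i\<^sup>2 \<sigma>\<^sup>2 / 2) = exp (- \<sigma>\<^sup>2 / 2)\<close>. The mean must be 0, since it would be
  multiplied by \<open>\<Sum>\<^sub>i a\<^sub>i\<close>.
\<close>

lemma distr_path_unit_combination:
  fixes M :: "'a measure" and N :: "'b measure" and T :: "'t set"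
    and X :: "'i \<Rightarrow> 't \<Rightarrow> 'b \<Rightarrow> real"
  assumes M: "prob_space M" and N: "prob_space N"
    and gauss: "gaussian_process M T \<eta>" and mean: "\<And>t. t \<in> T \<Longrightarrow> prob_space.expectation M (\<eta> t) = 0"
    and indep: "prob_space.indep_vars N (\<lambda>_. path_space T) (\<lambda>i. path T (X i)) I"
    and law: "\<And>i. i \<in> I \<Longrightarrow> distr N (path_space T) (path T (X i)) = distr M (path_space T) (path T \<eta>)"
    and a: "(\<Sum>i\<in>I. (a i)\<^sup>2) = 1"
    and meas: "path T (\<lambda>t \<omega>. \<Sum>i\<in>I. a i * X i t \<omega>) \<in> measurable N (path_space T)"
  shows "distr N (path_space T) (path T (\<lambda>t \<omega>. \<Sum>i\<in>I. a i * X i t \<omega>)) = distr M (path_space T) (path T \<eta>)"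
proof -
  interpret M: prob_space M by (rule M)
  interpret N: prob_space N by (rule N)
  note [measurable] = gaussian_process_measurable_path[OF gauss] meas
  have X_meas[measurable]: "path T (X i) \<in> measurable N (path_space T)" if "i \<in> I" for i
    using indep that unfolding N.indep_vars_def by auto
  show ?thesis
  proof (rule PiM_borel_eqI_char)
    fix J c assume J: "finite J" "J \<subseteq> T"
    define \<Lambda> :: "('t \<Rightarrow> real) \<Rightarrow> real" where "\<Lambda> x = (\<Sum>t\<in>J. c t * x t)" for x
    have \<Lambda>_meas[measurable]: "\<Lambda> \<in> borel_measurable (path_space T)"
      unfolding \<Lambda>_def using J by (auto intro!: borel_measurable_sum)
    have \<Lambda>_path: "\<Lambda> (path T Y \<omega>) = (\<Sum>t\<in>J. c t * Y t \<omega>)" for Y :: "'t \<Rightarrow> 'z \<Rightarrow> real" and \<omega>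
      unfolding \<Lambda>_def path_def using J by (intro sum.cong) auto
    define Z where "Z \<omega> = (\<Sum>t\<in>J. c t * \<eta> t \<omega>)" for \<omega>
    have gZ: "gaussian_rv M Z"
      unfolding Z_def using gauss[unfolded gaussian_process_def, rule_format, OF J] .
    have "integrable M (\<eta> t)" if "t \<in> J" for t
      using J that by (intro integrable_gaussian_rv[OF M] gaussian_process_imp_gaussian_rv[OF gauss]) auto
    then have "M.expectation Z = 0"
      unfolding Z_def using J mean by (subst Bochner_Integration.integral_sum) (auto intro!: sum.neutral)
    then obtain \<sigma> where \<sigma>: "\<And>u. (CLINT \<omega>|M. iexp (u * Z \<omega>)) = complex_of_real (exp (- (u\<^sup>2 * \<sigma>\<^sup>2) / 2))"
      using char_centered_gaussian_rv[OF M gZ] by blast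
    define V where "V i \<omega> = a i * \<Lambda> (path T (X i) \<omega>)" for i \<omega>
    have V_indep: "N.indep_vars (\<lambda>_. borel) V I"
      unfolding V_def by (rule N.indep_vars_compose2[OF indep, where Y = "\<lambda>i x. a i * \<Lambda> x"]) simp
    have V_meas[measurable]: "V i \<in> borel_measurable N" if "i \<in> I" for i
      using that unfolding V_def by measurable
    have V_char: "char (distr N borel (V i)) 1 = complex_of_real (exp (- ((a i)\<^sup>2 * \<sigma>\<^sup>2) / 2))" if i: "i \<in> I" for i
    proof -
      note [measurable] = X_meas[OF i] V_meas[OF i]
      have "char (distr N borel (V i)) 1 = (CLINT \<omega>|N. iexp (a i * \<Lambda> (path T (X i) \<omega>)))"
        unfolding char_def by (subst integral_distr) (auto simp: V_def)
      also have "\<dots> = (CLINT x|distr N (path_space T) (path T (X i)). iexp (a i * \<Lambda> x))"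
        by (subst integral_distr) auto
      also have "\<dots> = (CLINT \<omega>|M. iexp (a i * Z \<omega>))"
        unfolding law[OF i] by (subst integral_distr) (auto simp: \<Lambda>_path Z_def)
      finally show ?thesis by (simp only: \<sigma>)
    qed
    have "(CLINT x|distr N (path_space T) (path T (\<lambda>t \<omega>. \<Sum>i\<in>I. a i * X i t \<omega>)). iexp (\<Lambda> x)) =
       (CLINT \<omega>|N. iexp (\<Lambda> (path T (\<lambda>t \<omega>. \<Sum>i\<in>I. a i * X i t \<omega>) \<omega>)))"
      by (subst integral_distr) auto
    also have "\<dots> = (CLINT \<omega>|N. iexp (1 * (\<Sum>i\<in>I. V i \<omega>)))"
    proof -
      have "(\<Sum>t\<in>J. c t * (\<Sum>i\<in>I. a i * X i t \<omega>)) = (\<Sum>i\<in>I. V i \<omega>)" for \<omega>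
        unfolding V_def \<Lambda>_path sum_distrib_left
        by (subst sum.swap) (simp add: mult.left_commute)
      then show ?thesis by (simp add: \<Lambda>_path)
    qed
    also have "\<dots> = char (distr N borel (\<lambda>\<omega>. \<Sum>i\<in>I. V i \<omega>)) 1"
      unfolding char_def by (subst integral_distr) auto
    also have "\<dots> = (\<Prod>i\<in>I. complex_of_real (exp (- ((a i)\<^sup>2 * \<sigma>\<^sup>2) / 2)))"
      using V_char by (subst N.char_distr_sum[OF V_indep]) (rule prod.cong, auto)
    also have "\<dots> = complex_of_real (exp (\<Sum>i\<in>I. - ((a i)\<^sup>2 * \<sigma>\<^sup>2) / 2))"
      using a by (cases "finite I") (auto simp: exp_sum)
    also have "(\<Sum>i\<in>I. - ((a i)\<^sup>2 * \<sigma>\<^sup>2) / 2) = - (1\<^sup>2 * \<sigma>\<^sup>2) / 2"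
      by (simp add: a sum_negf flip: sum_divide_distrib sum_distrib_right)
    also have "complex_of_real (exp \<dots>) = (CLINT \<omega>|M. iexp (1 * Z \<omega>))" by (simp only: \<sigma>)
    also have "\<dots> = (CLINT x|distr M (path_space T) (path T \<eta>). iexp (\<Lambda> x))"
      by (subst integral_distr) (auto simp: \<Lambda>_path Z_def)
    finally show "(CLINT x|distr N (path_space T) (path T (\<lambda>t \<omega>. \<Sum>i\<in>I. a i * X i t \<omega>)). iexp (\<Sum>t\<in>J. c t * x t)) =
      (CLINT x|distr M (path_space T) (path T \<eta>). iexp (\<Sum>t\<in>J. c t * x t))"
      unfolding \<Lambda>_def .
  qed (auto intro: M.prob_space_distr N.prob_space_distr)
qed

section \<open>Limits superior along continuous paths\<close>

text \<open>
  The graph of \<open>\<phi>\<close> is separable as a subset of the plane. The set \<open>D\<close> consists of the times of a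
  countable dense subset, so each \<open>t\<close> is a limit of \<open>t\<^sub>n \<in> D\<close> for which also
  \<open>\<phi>(t\<^sub>n) \<rightarrow> \<phi>(t)\<close>. For continuous \<open>f\<close> the quotient \<open>f / \<phi>\<close> then has the same suprema over \<open>D\<close> as over
  all times, however irregular \<open>\<phi>\<close> is.
\<close>

lemma Limsup_at_right_eq_countable:
  fixes \<phi> :: "real \<Rightarrow> real"
  assumes b: "b > 0" and pos: "\<And>t. 0 < t \<Longrightarrow> t < b \<Longrightarrow> \<phi> t > 0"
  shows "\<exists>D. countable D \<and> D \<subseteq> {0<..<b} \<and>
    (\<forall>f. continuous_on {0<..<b} f \<longrightarrow>
       Limsup (at_right 0) (\<lambda>t. ereal (f t / \<phi> t)) = Limsup (at 0 within D) (\<lambda>t. ereal (f t / \<phi> t)))"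
proof -
  obtain G where G: "countable G" "G \<subseteq> (\<lambda>t. (t, \<phi> t)) ` {0<..<b}" "(\<lambda>t. (t, \<phi> t)) ` {0<..<b} \<subseteq> closure G"
    using separable[of "(\<lambda>t. (t, \<phi> t)) ` {0<..<b}"] by metis
  show ?thesis
  proof (intro exI[of _ "fst ` G"] conjI allI impI)
    show "countable (fst ` G)" using G by simp
    show D: "fst ` G \<subseteq> {0<..<b}" using G(2) by auto
    fix f :: "real \<Rightarrow> real" assume f: "continuous_on {0<..<b} f"
    have approx: "ereal (f t / \<phi> t) \<le> (SUP d\<in>fst ` G \<inter> ball 0 e - {0}. ereal (f d / \<phi> d))"
      if t: "0 < t" "t < b" "t < e" for t e
    proof -
      have "(t, \<phi> t) \<in> closure G" using G(3) t by auto
      then obtain x where x: "\<And>n. x n \<in> G" "x \<longlonglongrightarrow> (t, \<phi> t)"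
        by (auto simp: closure_sequential)
      have xG: "snd (x n) = \<phi> (fst (x n))" "fst (x n) \<in> {0<..<b}" "fst (x n) \<in> fst ` G" for n
        using x(1)[of n] G(2) by auto
      have l1: "(\<lambda>n. fst (x n)) \<longlonglongrightarrow> t" using tendsto_fst[OF x(2)] by simp
      have l2: "(\<lambda>n. \<phi> (fst (x n))) \<longlonglongrightarrow> \<phi> t" using tendsto_snd[OF x(2)] xG by simp
      have "(\<lambda>n. f (fst (x n))) \<longlonglongrightarrow> f t"
        using continuous_on_tendsto_compose[OF f l1] t xG(2) by simp
      then have "(\<lambda>n. f (fst (x n)) / \<phi> (fst (x n))) \<longlonglongrightarrow> f t / \<phi> t"
        using l2 pos[OF t(1,2)] by (intro tendsto_divide) auto
      then have "(\<lambda>n. ereal (f (fst (x n)) / \<phi> (fst (x n)))) \<longlonglongrightarrow> ereal (f t / \<phi> t)"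
        by simp
      moreover have "\<forall>\<^sub>F n in sequentially. fst (x n) < e"
        using order_tendstoD(2)[OF l1 t(3)] .
      then have "\<forall>\<^sub>F n in sequentially. ereal (f (fst (x n)) / \<phi> (fst (x n))) \<le>
          (SUP d\<in>fst ` G \<inter> ball 0 e - {0}. ereal (f d / \<phi> d))"
      proof eventually_elim
        case (elim n)
        then have "fst (x n) \<in> fst ` G \<inter> ball 0 e - {0}" using xG(2,3)[of n] by auto
        then show ?case by (rule SUP_upper)
      qed
      ultimately show ?thesis by (intro tendsto_upperbound[where F=sequentially]) auto
    qed
    show "Limsup (at_right 0) (\<lambda>t. ereal (f t / \<phi> t)) = Limsup (at 0 within fst ` G) (\<lambda>t. ereal (f t / \<phi> t))"
    proof (rule antisym)
      show "Limsup (at_right 0) (\<lambda>t. ereal (f t / \<phi> t)) \<le> Limsup (at 0 within fst ` G) (\<lambda>t. ereal (f t / \<phi> t))"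
        unfolding Limsup_within
      proof (rule INF_greatest)
        fix e :: real assume "e \<in> {0<..}"
        then have "min e b \<in> {0<..}" using b by auto
        moreover have "(SUP t\<in>{0<..} \<inter> ball 0 (min e b) - {0}. ereal (f t / \<phi> t)) \<le>
           (SUP d\<in>fst ` G \<inter> ball 0 e - {0}. ereal (f d / \<phi> d))"
          by (rule SUP_least) (auto intro!: approx)
        ultimately show "(INF e\<in>{0<..}. SUP t\<in>{0<..} \<inter> ball 0 e - {0}. ereal (f t / \<phi> t)) \<le>
           (SUP d\<in>fst ` G \<inter> ball 0 e - {0}. ereal (f d / \<phi> d))"
          by (rule INF_lower2)
      qed
      show "Limsup (at 0 within fst ` G) (\<lambda>t. ereal (f t / \<phi> t)) \<le> Limsup (at_right 0) (\<lambda>t. ereal (f t / \<phi> t))"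
        unfolding Limsup_within using D by (intro INF_mono' SUP_subset_mono) auto
    qed
  qed
qed

lemma borel_measurable_Limsup_within_countable:
  fixes g :: "real \<Rightarrow> 'a \<Rightarrow> ereal"
  assumes "countable D" and "\<And>t. t \<in> D \<Longrightarrow> g t \<in> borel_measurable M"
  shows "(\<lambda>x. Limsup (at a within D) (\<lambda>t. g t x)) \<in> borel_measurable M"
proof -
  have "Limsup (at a within D) (\<lambda>t. g t x) = (INF n::nat. SUP t\<in>D \<inter> ball a (1 / real (Suc n)) - {a}. g t x)" for x
    unfolding Limsup_within
  proof (rule INF_eq)
    fix e :: real assume "e \<in> {0<..}"
    then obtain n where "1 / real (Suc n) < e" using nat_approx_posE by auto
    then show "\<exists>n\<in>UNIV. (SUP t\<in>D \<inter> ball a (1 / real (Suc n)) - {a}. g t x) \<le> (SUP t\<in>D \<inter> ball a e - {a}. g t x)"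
      by (intro bexI[of _ n] SUP_subset_mono) auto
  next
    fix n :: nat
    show "\<exists>e\<in>{0<..}. (SUP t\<in>D \<inter> ball a e - {a}. g t x) \<le> (SUP t\<in>D \<inter> ball a (1 / real (Suc n)) - {a}. g t x)"
      by (intro bexI[of _ "1 / real (Suc n)"]) auto
  qed
  then show ?thesis
    using assms by (auto intro!: borel_measurable_INF borel_measurable_SUP intro: countable_subset)
qed

text \<open>
  On continuous paths the limit superior agrees with a measurable functional \<open>S\<close> of the path, so its
  almost sure value depends only on the law of the path.
\<close>

lemma AE_Limsup_transfer:
  fixes \<phi> :: "real \<Rightarrow> real"
  assumes meas: "path {0..1} \<xi> \<in> measurable M (path_space {0..1})" "path {0..1} \<zeta> \<in> measurable N (path_space {0..1})"
    and law: "distr N (path_space {0..1}) (path {0..1} \<zeta>) = distr M (path_space {0..1}) (path {0..1} \<xi>)"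
    and cont: "continuous_process M {0..1} \<xi>" "continuous_process N {0..1} \<zeta>"
    and "\<delta> > 0" and pos: "\<And>t. t \<in> {0..\<delta>} \<Longrightarrow> \<phi> t > 0"
    and lim: "AE \<omega> in M. Limsup (at_right 0) (\<lambda>t. ereal ((\<xi> t \<omega> - \<xi> 0 \<omega>) / \<phi> t)) = l"
  shows "AE \<omega> in N. Limsup (at_right 0) (\<lambda>t. ereal ((\<zeta> t \<omega> - \<zeta> 0 \<omega>) / \<phi> t)) = l"
proof -
  define b where "b = min \<delta> 1"
  have b: "b > 0" "b \<le> 1" "b \<le> \<delta>" using \<open>\<delta> > 0\<close> by (auto simp: b_def)
  have posb: "\<phi> t > 0" if "0 < t" "t < b" for t using pos[of t] that b by auto
  obtain D where D: "countable D \<and> D \<subseteq> {0<..<b} \<and>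
    (\<forall>f. continuous_on {0<..<b} f \<longrightarrow>
       Limsup (at_right 0) (\<lambda>t. ereal (f t / \<phi> t)) = Limsup (at 0 within D) (\<lambda>t. ereal (f t / \<phi> t)))"
    using Limsup_at_right_eq_countable[OF b(1) posb] ..
  note D = conjunct1[OF D] conjunct1[OF conjunct2[OF D]] conjunct2[OF conjunct2[OF D], rule_format]
  define S where "S x = Limsup (at 0 within D) (\<lambda>t. ereal ((x t - x 0) / \<phi> t))" for x :: "real \<Rightarrow> real"
  have [measurable]: "S \<in> borel_measurable (path_space {0..1})"
    unfolding S_def
    using D(1,2) b by (intro borel_measurable_Limsup_within_countable) (auto intro!: borel_measurable_ereal borel_measurable_divide borel_measurable_diff measurable_component_singleton)
  have ball: "t \<in> D \<Longrightarrow> t \<in> {0..1}" for t using D(2) b by auto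
  have S_path: "S (path {0..1} Y \<omega>) = Limsup (at_right 0) (\<lambda>t. ereal ((Y t \<omega> - Y 0 \<omega>) / \<phi> t))"
    if "continuous_on {0..1} (\<lambda>t. Y t \<omega>)" for Y :: "real \<Rightarrow> 'z \<Rightarrow> real" and \<omega>
  proof -
    have "continuous_on {0<..<b} (\<lambda>t. Y t \<omega> - Y 0 \<omega>)"
      using that b by (intro continuous_on_diff continuous_on_const) (auto elim!: continuous_on_subset)
    then have "Limsup (at_right 0) (\<lambda>t. ereal ((Y t \<omega> - Y 0 \<omega>) / \<phi> t)) =
        Limsup (at 0 within D) (\<lambda>t. ereal ((Y t \<omega> - Y 0 \<omega>) / \<phi> t))"
      by (rule D(3))
    also have "\<dots> = S (path {0..1} Y \<omega>)"
      unfolding S_def using ball by (intro Limsup_eq) (auto simp: eventually_at_filter path_def)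
    finally show ?thesis ..
  qed
  have "AE \<omega> in M. S (path {0..1} \<xi> \<omega>) = l"
    using lim cont(1) unfolding continuous_process_def by eventually_elim (simp add: S_path)
  then have "AE x in distr M (path_space {0..1}) (path {0..1} \<xi>). S x = l"
    using meas by (subst AE_distr_iff) auto
  then have "AE \<omega> in N. S (path {0..1} \<zeta> \<omega>) = l"
    unfolding law[symmetric] using meas by (subst (asm) AE_distr_iff) auto
  then show ?thesis
    using cont(2) unfolding continuous_process_def by eventually_elim (simp add: S_path)
qed

section \<open>Increments of the chi-square process\<close>

lemma Limsup_eq_of_approximations:
  fixes g :: "'a \<Rightarrow> real"
  assumes F: "F \<noteq> bot"
    and approx: "\<And>e. e > 0 \<Longrightarrow> \<exists>h m. Limsup F (\<lambda>t. ereal (h t)) = ereal m \<and> \<bar>m - L\<bar> \<le> e \<and> (\<forall>\<^sub>F t in F. \<bar>g t - h t\<bar> \<le> e)"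
  shows "Limsup F (\<lambda>t. ereal (g t)) = ereal L"
proof -
  have bounds: "Limsup F (\<lambda>t. ereal (g t)) \<le> ereal L + ereal e \<and> ereal L \<le> Limsup F (\<lambda>t. ereal (g t)) + ereal e"
    if e: "e > 0" for e
  proof -
    obtain h m where h: "Limsup F (\<lambda>t. ereal (h t)) = ereal m" "\<bar>m - L\<bar> \<le> e / 2" "\<forall>\<^sub>F t in F. \<bar>g t - h t\<bar> \<le> e / 2"
      using approx[of "e / 2"] e by auto
    have mL: "m \<le> L + e / 2" "L \<le> m + e / 2"
      using h(2) by arith+
    have close: "\<forall>\<^sub>F t in F. g t \<le> h t + e / 2 \<and> h t \<le> g t + e / 2"
      using h(3) by eventually_elim arith
    have "Limsup F (\<lambda>t. ereal (g t)) \<le> Limsup F (\<lambda>t. ereal (h t) + ereal (e / 2))"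
      using close by (intro Limsup_mono) (auto elim!: eventually_mono)
    also have "\<dots> = ereal m + ereal (e / 2)"
      using F by (subst Limsup_add_ereal_right) (auto simp: h)
    also have "\<dots> \<le> ereal L + ereal e" using mL by simp
    finally have 1: "Limsup F (\<lambda>t. ereal (g t)) \<le> ereal L + ereal e" .
    have "ereal m = Limsup F (\<lambda>t. ereal (h t))" by (simp add: h)
    also have "\<dots> \<le> Limsup F (\<lambda>t. ereal (g t) + ereal (e / 2))"
      using close by (intro Limsup_mono) (auto elim!: eventually_mono)
    also have "\<dots> = Limsup F (\<lambda>t. ereal (g t)) + ereal (e / 2)"
      using F by (subst Limsup_add_ereal_right) auto
    finally have "ereal m + ereal (e / 2) \<le> Limsup F (\<lambda>t. ereal (g t)) + ereal e"
      by (cases "Limsup F (\<lambda>t. ereal (g t))") auto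
    moreover have "ereal L \<le> ereal m + ereal (e / 2)" using mL by simp
    ultimately have "ereal L \<le> Limsup F (\<lambda>t. ereal (g t)) + ereal e"
      by (rule order_trans[rotated])
    with 1 show ?thesis ..
  qed
  show ?thesis
    by (rule antisym) (use bounds in \<open>auto intro: ereal_le_epsilon2\<close>)
qed

text \<open>
  The deterministic core, for a single path. The vector \<open>x(0)\<close> is approximated by a rational vector
  \<open>a\<close>, and \<open>x\<^sub>i(t)\<^sup>2 - x\<^sub>i(0)\<^sup>2 - 2 a\<^sub>i \<Delta>\<^sub>i = (\<Delta>\<^sub>i + 2 (x\<^sub>i(0) - a\<^sub>i)) \<Delta>\<^sub>i\<close> is a small factor
  times a quantity of order \<open>\<phi>(t)\<close>.
\<close>

lemma Limsup_chi_square_increment: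
  fixes x :: "'i \<Rightarrow> real \<Rightarrow> real" and \<phi> :: "real \<Rightarrow> real"
  assumes I: "finite I" and "\<delta> > 0" and pos: "\<And>t. t \<in> {0..\<delta>} \<Longrightarrow> \<phi> t > 0"
    and cont: "\<And>i. i \<in> I \<Longrightarrow> (x i \<longlongrightarrow> x i 0) (at_right 0)"
    and abs_le: "\<And>i. i \<in> I \<Longrightarrow> \<forall>\<^sub>F t in at_right 0. \<bar>x i t - x i 0\<bar> \<le> 2 * \<phi> t"
    and lim: "\<And>a. a \<in> I \<rightarrow>\<^sub>E \<rat> \<Longrightarrow> Limsup (at_right 0) (\<lambda>t. ereal ((\<Sum>i\<in>I. a i * (x i t - x i 0)) / \<phi> t)) = L2_set a I"
  shows "Limsup (at_right 0) (\<lambda>t. ereal (((\<Sum>i\<in>I. (x i t)\<^sup>2) - (\<Sum>i\<in>I. (x i 0)\<^sup>2)) / \<phi> t))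
    = ereal (2 * sqrt (\<Sum>i\<in>I. (x i 0)\<^sup>2))"
proof (rule Limsup_eq_of_approximations)
  fix e :: real assume e: "e > 0"
  \<comment> \<open>With every coordinate of \<open>a\<close> within \<open>d\<close> of \<open>x(0)\<close> and \<open>\<bar>\<Delta>\<^sub>i\<bar> < d\<close>, each summand contributes
    at most \<open>3 d \<cdot> 2 \<phi>\<close>; the summand 1 in the denominator covers an empty \<open>I\<close>.\<close>
  define d where "d = e / (6 * (card I + 1))"
  have d: "d > 0" "6 * card I * d \<le> e" using e by (auto simp: d_def field_simps)
  have "\<exists>r\<in>\<rat>. \<bar>r - x i 0\<bar> \<le> d" for i
  proof -
    obtain q where "q \<in> \<rat>" "x i 0 < q" "q < x i 0 + d"
      using Rats_dense_in_real[of "x i 0" "x i 0 + d"] d(1) by auto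
    then show ?thesis by (intro bexI[of _ q]) auto
  qed
  then obtain r where r: "\<And>i. r i \<in> \<rat>" "\<And>i. \<bar>r i - x i 0\<bar> \<le> d" by metis
  define a where "a = restrict r I"
  have a: "a \<in> I \<rightarrow>\<^sub>E \<rat>" "\<And>i. i \<in> I \<Longrightarrow> \<bar>a i - x i 0\<bar> \<le> d" using r by (auto simp: a_def)
  have suma: "(\<Sum>i\<in>I. \<bar>a i - x i 0\<bar>) \<le> card I * d"
    using a(2) by (rule sum_bounded_above)
  have "L2_set a I \<le> L2_set (\<lambda>i. x i 0) I + L2_set (\<lambda>i. a i - x i 0) I"
    using L2_set_triangle_ineq[of "\<lambda>i. x i 0" "\<lambda>i. a i - x i 0" I] by simp
  moreover have "L2_set (\<lambda>i. x i 0) I \<le> L2_set a I + L2_set (\<lambda>i. x i 0 - a i) I"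
    using L2_set_triangle_ineq[of a "\<lambda>i. x i 0 - a i" I] by simp
  moreover have "L2_set (\<lambda>i. x i 0 - a i) I \<le> card I * d" "L2_set (\<lambda>i. a i - x i 0) I \<le> card I * d"
    using order_trans[OF L2_set_le_sum_abs suma] L2_set_le_sum_abs[of "\<lambda>i. x i 0 - a i" I] suma
    by (auto simp: abs_minus_commute)
  moreover have "sqrt (\<Sum>i\<in>I. (x i 0)\<^sup>2) = L2_set (\<lambda>i. x i 0) I" by (simp add: L2_set_def)
  ultimately have norm_close: "\<bar>2 * L2_set a I - 2 * sqrt (\<Sum>i\<in>I. (x i 0)\<^sup>2)\<bar> \<le> e"
    using d by (simp add: abs_le_iff)
  have "Limsup (at_right 0) (\<lambda>t. ereal 2 * ereal ((\<Sum>i\<in>I. a i * (x i t - x i 0)) / \<phi> t)) = ereal 2 * L2_set a I"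
    by (subst Limsup_ereal_mult_left) (auto simp: lim[OF a(1)])
  then have lim_a: "Limsup (at_right 0) (\<lambda>t. ereal (2 * ((\<Sum>i\<in>I. a i * (x i t - x i 0)) / \<phi> t))) = ereal (2 * L2_set a I)"
    by simp
  have "\<forall>\<^sub>F t in at_right 0. t < \<delta> \<and> 0 < t"
    using \<open>\<delta> > 0\<close> by (auto simp: eventually_at_right_field intro: exI[of _ \<delta>])
  moreover have "\<forall>\<^sub>F t in at_right 0. \<forall>i\<in>I. \<bar>x i t - x i 0\<bar> \<le> 2 * \<phi> t"
    using abs_le I by (intro eventually_ball_finite) auto
  moreover have "\<forall>\<^sub>F t in at_right 0. \<forall>i\<in>I. \<bar>x i t - x i 0\<bar> < d"
    using tendstoD[OF cont d(1)] I by (intro eventually_ball_finite) (auto simp: dist_real_def)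
  ultimately have "\<forall>\<^sub>F t in at_right 0. \<bar>((\<Sum>i\<in>I. (x i t)\<^sup>2) - (\<Sum>i\<in>I. (x i 0)\<^sup>2)) / \<phi> t -
      2 * ((\<Sum>i\<in>I. a i * (x i t - x i 0)) / \<phi> t)\<bar> \<le> e"
  proof eventually_elim
    case (elim t)
    have p: "\<phi> t > 0" using pos[of t] elim by auto
    have "\<bar>(x i t)\<^sup>2 - (x i 0)\<^sup>2 - 2 * (a i * (x i t - x i 0))\<bar> \<le> 6 * d * \<phi> t" if i: "i \<in> I" for i
    proof -
      have "(x i t)\<^sup>2 - (x i 0)\<^sup>2 - 2 * (a i * (x i t - x i 0)) =
          ((x i t - x i 0) + 2 * (x i 0 - a i)) * (x i t - x i 0)"
        by (simp add: power2_eq_square algebra_simps)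
      also have "\<bar>\<dots>\<bar> = \<bar>(x i t - x i 0) + 2 * (x i 0 - a i)\<bar> * \<bar>x i t - x i 0\<bar>" by (rule abs_mult)
      also have "\<dots> \<le> (3 * d) * (2 * \<phi> t)"
      proof (rule mult_mono)
        have "\<bar>x i t - x i 0\<bar> < d" using elim i by blast
        moreover have "\<bar>2 * (x i 0 - a i)\<bar> \<le> 2 * d"
          using a(2)[OF i] unfolding abs_mult by (simp add: abs_minus_commute)
        moreover note abs_triangle_ineq[of "x i t - x i 0" "2 * (x i 0 - a i)"]
        ultimately show "\<bar>(x i t - x i 0) + 2 * (x i 0 - a i)\<bar> \<le> 3 * d"
          by (smt (verit))
      qed (use elim i d in auto)
      finally show ?thesis by simp
    qed
    then have "(\<Sum>i\<in>I. \<bar>(x i t)\<^sup>2 - (x i 0)\<^sup>2 - 2 * (a i * (x i t - x i 0))\<bar>) \<le> card I * (6 * d * \<phi> t)"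
      by (rule sum_bounded_above)
    with sum_abs have "\<bar>\<Sum>i\<in>I. (x i t)\<^sup>2 - (x i 0)\<^sup>2 - 2 * (a i * (x i t - x i 0))\<bar> \<le> card I * (6 * d * \<phi> t)"
      by (rule order_trans)
    also have "\<dots> = (6 * card I * d) * \<phi> t" by simp
    also have "\<dots> \<le> e * \<phi> t" using d p by (intro mult_right_mono) auto
    finally have "\<bar>(\<Sum>i\<in>I. (x i t)\<^sup>2) - (\<Sum>i\<in>I. (x i 0)\<^sup>2) - 2 * (\<Sum>i\<in>I. a i * (x i t - x i 0))\<bar> \<le> e * \<phi> t"
      by (simp add: sum_subtractf sum_distrib_left)
    then have "\<bar>((\<Sum>i\<in>I. (x i t)\<^sup>2) - (\<Sum>i\<in>I. (x i 0)\<^sup>2) - 2 * (\<Sum>i\<in>I. a i * (x i t - x i 0))) / \<phi> t\<bar> \<le> e"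
      using p by (simp add: abs_divide pos_divide_le_eq)
    then show ?case by (simp add: diff_divide_distrib)
  qed
  with lim_a norm_close
  show "\<exists>h m. Limsup (at_right 0) (\<lambda>t. ereal (h t)) = ereal m \<and> \<bar>m - 2 * sqrt (\<Sum>i\<in>I. (x i 0)\<^sup>2)\<bar> \<le> e \<and>
    (\<forall>\<^sub>F t in at_right 0. \<bar>((\<Sum>i\<in>I. (x i t)\<^sup>2) - (\<Sum>i\<in>I. (x i 0)\<^sup>2)) / \<phi> t - h t\<bar> \<le> e)"
    by (intro exI[of _ "\<lambda>t. 2 * ((\<Sum>i\<in>I. a i * (x i t - x i 0)) / \<phi> t)"] exI[of _ "2 * L2_set a I"] conjI)
qed simp

theorem theorem1p1:
  fixes M :: "'a measure" and N :: "'b measure"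
    and \<eta> :: "real \<Rightarrow> 'a \<Rightarrow> real" and X :: "nat \<Rightarrow> real \<Rightarrow> 'b \<Rightarrow> real"
    and U :: "real \<Rightarrow> real \<Rightarrow> real" and \<phi> :: "real \<Rightarrow> real" and \<delta> :: real and k :: nat
  assumes "prob_space M" and "prob_space N"
    and "mean_zero_continuous_gaussian_process M {0..1} U \<eta>"
    and "U 0 0 > 0"
    and "\<delta> > 0" and "\<And>t. t \<in> {0..\<delta>} \<Longrightarrow> \<phi> t > 0"
    and "AE \<omega> in M. Limsup (at_right 0) (\<lambda>t. ereal ((\<eta> t \<omega> - \<eta> 0 \<omega>) / \<phi> t)) = 1"
    and "k \<ge> 1"
    and "independent_copies N {1..k} X M {0..1} \<eta>"
  shows "AE \<omega> in N.
    Limsup (at_right 0)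
      (\<lambda>t. ereal ((chi_square_process X k t \<omega> - chi_square_process X k 0 \<omega>) / \<phi> t))
    = ereal (2 * sqrt (chi_square_process X k 0 \<omega>))"
proof -
  let ?T = "{0..1::real}" and ?I = "{1..k}"
  interpret N: prob_space N by fact
  have gauss: "gaussian_process M ?T \<eta>" and cont: "continuous_process M ?T \<eta>"
    and mean: "\<And>t. t \<in> ?T \<Longrightarrow> prob_space.expectation M (\<eta> t) = 0"
    using assms(3) by (auto simp: mean_zero_continuous_gaussian_process_def)
  have indep: "N.indep_vars (\<lambda>_. path_space ?T) (\<lambda>i. path ?T (X i)) ?I"
    and law: "\<And>i. i \<in> ?I \<Longrightarrow> distr N (path_space ?T) (path ?T (X i)) = distr M (path_space ?T) (path ?T \<eta>)"
    and X_cont: "\<And>i. i \<in> ?I \<Longrightarrow> continuous_process N ?T (X i)"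
    using assms(9) cont by (auto simp: independent_copies_def)
  have X_meas: "X i t \<in> borel_measurable N" if "i \<in> ?I" "t \<in> ?T" for i t
  proof -
    have "path ?T (X i) \<in> measurable N (path_space ?T)"
      using indep that(1) unfolding N.indep_vars_def by auto
    from measurable_compose[OF this measurable_component_singleton[OF that(2)]]
    have "(\<lambda>\<omega>. path ?T (X i) \<omega> t) \<in> borel_measurable N" .
    then show ?thesis using that(2) by (simp add: path_def)
  qed
  have AE_cont: "AE \<omega> in N. \<forall>i\<in>?I. continuous_on ?T (\<lambda>t. X i t \<omega>)"
    using X_cont unfolding continuous_process_def by (intro AE_finite_allI) auto
  have unit: "AE \<omega> in N. Limsup (at_right 0) (\<lambda>t. ereal ((\<Sum>i\<in>?I. a i * (X i t \<omega> - X i 0 \<omega>)) / \<phi> t)) = 1"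
    if a: "(\<Sum>i\<in>?I. (a i)\<^sup>2) = 1" for a
  proof -
    have meas: "path ?T (\<lambda>t \<omega>. \<Sum>i\<in>?I. a i * X i t \<omega>) \<in> measurable N (path_space ?T)"
      unfolding path_def using X_meas by (intro measurable_restrict borel_measurable_sum borel_measurable_times) auto
    have "continuous_process N ?T (\<lambda>t \<omega>. \<Sum>i\<in>?I. a i * X i t \<omega>)"
      unfolding continuous_process_def using AE_cont
      by eventually_elim (intro continuous_on_sum continuous_on_mult continuous_on_const, auto)
    then have "AE \<omega> in N. Limsup (at_right 0) (\<lambda>t. ereal (((\<Sum>i\<in>?I. a i * X i t \<omega>) - (\<Sum>i\<in>?I. a i * X i 0 \<omega>)) / \<phi> t)) = 1"
      by (intro AE_Limsup_transfer[OF gaussian_process_measurable_path[OF gauss] meas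
          distr_path_unit_combination[OF assms(1,2) gauss mean indep law a meas] cont _ assms(5,6,7)])
    then show ?thesis by (simp add: right_diff_distrib sum_subtractf)
  qed
  have scaled: "AE \<omega> in N. Limsup (at_right 0) (\<lambda>t. ereal ((\<Sum>i\<in>?I. a i * (X i t \<omega> - X i 0 \<omega>)) / \<phi> t)) = L2_set a ?I"
    for a
  proof (cases "L2_set a ?I = 0")
    case True
    then have "a i = 0" if "i \<in> ?I" for i using that by (simp add: L2_set_eq_0_iff)
    then have "(\<Sum>i\<in>?I. a i * (X i t \<omega> - X i 0 \<omega>)) = 0" for t \<omega>
      by (intro sum.neutral) auto
    then show ?thesis using True by (simp add: Limsup_const zero_ereal_def)
  next
    case False
    let ?n = "L2_set a ?I"
    have n: "?n > 0" using False L2_set_nonneg[of a ?I] by linarith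
    have "(\<Sum>i\<in>?I. (a i / ?n)\<^sup>2) = (\<Sum>i\<in>?I. (a i)\<^sup>2) / ?n\<^sup>2"
      by (simp add: power_divide sum_divide_distrib)
    also have "?n\<^sup>2 = (\<Sum>i\<in>?I. (a i)\<^sup>2)" by (simp add: L2_set_def sum_nonneg)
    also have "(\<Sum>i\<in>?I. (a i)\<^sup>2) / \<dots> = 1"
      using False by (simp add: L2_set_def)
    finally have "(\<Sum>i\<in>?I. (a i / ?n)\<^sup>2) = 1" .
    from unit[OF this] show ?thesis
    proof eventually_elim
      case (elim \<omega>)
      have rescale: "(\<Sum>i\<in>?I. a i * (X i t \<omega> - X i 0 \<omega>)) / \<phi> t = ?n * ((\<Sum>i\<in>?I. a i / ?n * (X i t \<omega> - X i 0 \<omega>)) / \<phi> t)" for t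
        using n by (simp add: sum_distrib_left sum_divide_distrib)
      have "Limsup (at_right 0) (\<lambda>t. ereal ((\<Sum>i\<in>?I. a i * (X i t \<omega> - X i 0 \<omega>)) / \<phi> t)) =
         Limsup (at_right 0) (\<lambda>t. ereal ?n * ereal ((\<Sum>i\<in>?I. a i / ?n * (X i t \<omega> - X i 0 \<omega>)) / \<phi> t))"
        by (simp only: rescale times_ereal.simps)
      also have "\<dots> = ereal ?n * Limsup (at_right 0) (\<lambda>t. ereal ((\<Sum>i\<in>?I. a i / ?n * (X i t \<omega> - X i 0 \<omega>)) / \<phi> t))"
        using n by (intro Limsup_ereal_mult_left) auto
      also note elim
      finally show ?case by simp
    qed
  qed
  have "countable (?I \<rightarrow>\<^sub>E (\<rat> :: real set))"
    by (intro countable_PiE) (auto simp: countable_rat)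
  then have all_rat: "AE \<omega> in N. \<forall>a\<in>?I \<rightarrow>\<^sub>E \<rat>.
      Limsup (at_right 0) (\<lambda>t. ereal ((\<Sum>i\<in>?I. a i * (X i t \<omega> - X i 0 \<omega>)) / \<phi> t)) = L2_set a ?I"
    using scaled by (intro AE_ball_countable') auto
  from all_rat AE_cont show ?thesis
  proof eventually_elim
    case (elim \<omega>)
    \<comment> \<open>The vectors \<open>\<plusminus>e\<^sub>i\<close> are rational, which bounds each increment from both sides.\<close>
    have single: "\<forall>\<^sub>F t in at_right 0. s * (X i t \<omega> - X i 0 \<omega>) / \<phi> t < 2" if i: "i \<in> ?I" and s: "s \<in> \<rat>" "\<bar>s\<bar> = 1" for i s
    proof -
      define a where "a = restrict (\<lambda>j. if j = i then s else 0) ?I"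
      have "a \<in> ?I \<rightarrow>\<^sub>E \<rat>" using s by (auto simp: a_def)
      moreover have "(\<Sum>j\<in>?I. a j * (X j t \<omega> - X j 0 \<omega>)) = s * (X i t \<omega> - X i 0 \<omega>)" for t
      proof -
        have "(\<Sum>j\<in>?I. a j * (X j t \<omega> - X j 0 \<omega>)) = (\<Sum>j\<in>?I. if j = i then s * (X i t \<omega> - X i 0 \<omega>) else 0)"
          by (intro sum.cong) (auto simp: a_def)
        then show ?thesis using i by simp
      qed
      moreover have "L2_set a ?I = 1"
      proof -
        have "(\<Sum>j\<in>?I. (a j)\<^sup>2) = (\<Sum>j\<in>?I. if j = i then s\<^sup>2 else 0)"
          by (intro sum.cong) (auto simp: a_def)
        then show ?thesis using i s by (simp add: L2_set_def)
      qed
      ultimately have "Limsup (at_right 0) (\<lambda>t. ereal (s * (X i t \<omega> - X i 0 \<omega>) / \<phi> t)) = 1"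
        using bspec[OF elim(1), of a] by (simp add: one_ereal_def)
      then have "Limsup (at_right 0) (\<lambda>t. ereal (s * (X i t \<omega> - X i 0 \<omega>) / \<phi> t)) < ereal 2"
        by (simp add: one_ereal_def)
      from Limsup_lessD[OF this] show ?thesis by simp
    qed
    have abs_le: "\<forall>\<^sub>F t in at_right 0. \<bar>X i t \<omega> - X i 0 \<omega>\<bar> \<le> 2 * \<phi> t" if i: "i \<in> ?I" for i
    proof -
      have "\<forall>\<^sub>F t in at_right 0. t < \<delta> \<and> 0 < t"
        using \<open>\<delta> > 0\<close> by (auto simp: eventually_at_right_field intro: exI[of _ \<delta>])
      then show ?thesis using single[OF i, of 1, simplified] single[OF i, of "-1", simplified]
      proof eventually_elim
        case (elim t)
        then have "\<phi> t > 0" using assms(6)[of t] by auto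
        then show ?case using elim by (auto simp: abs_le_iff field_simps)
      qed
    qed
    have X_tendsto: "((\<lambda>t. X i t \<omega>) \<longlongrightarrow> X i 0 \<omega>) (at_right 0)" if "i \<in> ?I" for i
    proof -
      have "((\<lambda>t. X i t \<omega>) \<longlongrightarrow> X i 0 \<omega>) (at 0 within {0..1})"
        using elim(2) that unfolding continuous_on_def by auto
      then show ?thesis
        by (rule filterlim_mono[OF _ order_refl]) (auto simp: at_within_Icc_at_right)
    qed
    show ?case
      unfolding chi_square_process_def
      by (rule Limsup_chi_square_increment[where x = "\<lambda>i t. X i t \<omega>", OF _ assms(5,6) X_tendsto abs_le])
        (use elim(1) in auto)
  qed
qed

end
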